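(* For all non-negative integers $n,k$: $\mathcal B_{n,k}\in\mathbb Z$, and $\mathcal B_{n,k}=0$ whenever $n-k$ is odd. Moreover, for all integers $n\ge 0$ and $x\ge n$, $$\mathcal B_{x,x-n}=\sum_{u\ge0}\binom{n+x}{n-u}\binom{n-x}{n+u}\mathcal A_{n+u,u},\qquad \mathcal A_{x,x-n}=\sum_{u\ge0}\binom{n+x}{n-u}\binom{n-x}{n+u}\mathcal B_{n+u,u}.$$
   Context: Conventions: $B_h$ are the Bernoulli numbers ($\frac{t}{e^t-1}=\sum_{h\ge0}B_h\frac{t^h}{h!}$, so $B_1=-\tfrac12$); binomial coefficients $\binom{N}{h}$ for any integer $N$ are defined by $\sum_h\binom{N}{h}x^h=(1+x)^N$ (so they vanish for $h<0$, and $\binom{-N}{h}=(-1)^h\binom{N+h-1}{N-1}$ for $N>0$); $0^0=1$. ${n\brack m}$ is the unsigned Stirling number of the first kind, $\sum_m{n\brack m}y^m=\prod_{j=0}^{n-1}(y+j)$; ${n\brace m}$ is the Stirling number of the second kind, $\sum_{n\ge0}{n\brace m}\frac{y^n}{n!}=\frac{(e^y-1)^m}{m!}$; both vanish for $m>n$ or $m<0$. Define, for non-negative integers $n,k$, $$\mathcal A_{n,k}:=\sum_{h\ge 0}B_h\binom{k+h-1}{h}{n\brack h+k}n^h,\qquad \mathcal B_{n,k}:=\sum_{h\ge0}B_h\binom{n}{h}{n-h\brace k}k^h.$$ *)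

theory Defs
  imports
    "HOL-Library.Groups_Big_Fun"
    "HOL-Combinatorics.Stirling"
    "HOL-Computational_Algebra.Formal_Power_Series"
begin

definition bernoulli :: "nat \<Rightarrow> rat" where
  "bernoulli h = fact h * fps_nth (fps_X / (fps_exp 1 - 1)) h"

text \<open>The division of power series above is exact.\<close>

lemma bernoulli_fps:
  "Abs_fps (\<lambda>h. bernoulli h / fact h) * (fps_exp 1 - 1) = fps_X"
proof -
  have sub: "subdegree (fps_exp 1 - 1 :: rat fps) = 1"
    by (rule subdegreeI) auto
  then have "(fps_exp 1 - 1 :: rat fps) dvd fps_X"
    by (subst fps_dvd_iff) auto
  moreover have "Abs_fps (\<lambda>h. bernoulli h / fact h) = fps_X / (fps_exp 1 - 1)"
    by (simp add: fps_eq_iff bernoulli_def)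
  ultimately show ?thesis
    by simp
qed

text \<open>The binomial coefficient for arbitrary integers \<open>N\<close> and \<open>h\<close>: the coefficient of \<open>x ^ h\<close>
  in \<open>(1 + x) ^ N\<close>, in particular 0 for negative \<open>h\<close>.\<close>

definition ibinom :: "int \<Rightarrow> int \<Rightarrow> rat" where
  "ibinom N h = (if h < 0 then 0 else of_int N gchoose nat h)"

lemma ibinom_fps_nonneg: "Abs_fps (\<lambda>h. ibinom (int N) (int h)) = (1 + fps_X) ^ N"
  by (simp add: ibinom_def fps_eq_iff fps_binomial_of_nat [symmetric])

lemma ibinom_fps_neg: "Abs_fps (\<lambda>h. ibinom (- int N) (int h)) = inverse ((1 + fps_X) ^ N)"
  by (simp add: ibinom_def fps_eq_iff fps_binomial_minus_of_nat [symmetric])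

text \<open>\<open>Sum_any\<close> is the sum over the support, which is finite in all uses here. In \<open>\<B>\<close>, the
  truncated subtraction \<open>n - h\<close> is harmless: for \<open>h > n\<close> the binomial coefficient vanishes.\<close>

definition stirlA :: "nat \<Rightarrow> nat \<Rightarrow> rat" (\<open>\<A>\<close>) where
  "\<A> n k = Sum_any (\<lambda>h. bernoulli h * ibinom (int k + int h - 1) (int h)
                        * of_nat (stirling n (h + k)) * of_nat n ^ h)"

definition stirlB :: "nat \<Rightarrow> nat \<Rightarrow> rat" (\<open>\<B>\<close>) where
  "\<B> n k = Sum_any (\<lambda>h. bernoulli h * ibinom (int n) (int h)
                        * of_nat (Stirling (n - h) k) * of_nat k ^ h)"

lemma stirlA_finite_sum:
  "\<A> n k = (\<Sum>h\<le>n. bernoulli h * ibinom (int k + int h - 1) (int h)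
                    * of_nat (stirling n (h + k)) * of_nat n ^ h)"
  unfolding stirlA_def
proof (rule Sum_any.expand_superset)
  show "{h. bernoulli h * ibinom (int k + int h - 1) (int h)
           * of_nat (stirling n (h + k)) * of_nat n ^ h \<noteq> 0} \<subseteq> {..n}"
    by (auto intro!: leI)
qed simp

lemma stirlB_finite_sum:
  "\<B> n k = (\<Sum>h\<le>n. bernoulli h * ibinom (int n) (int h)
                    * of_nat (Stirling (n - h) k) * of_nat k ^ h)"
  unfolding stirlB_def
proof (rule Sum_any.expand_superset)
  have "ibinom (int n) (int h) = 0" if "h > n" for h
    using that by (simp add: ibinom_def flip: binomial_gbinomial)
  then show "{h. bernoulli h * ibinom (int n) (int h)
           * of_nat (Stirling (n - h) k) * of_nat k ^ h \<noteq> 0} \<subseteq> {..n}"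
    by (auto intro!: leI)
qed simp

lemma ibinom_Sum_any_finite_sum:
  "Sum_any (\<lambda>u. ibinom N (int n - int u) * g u * f u) =
     (\<Sum>u\<le>n. ibinom N (int n - int u) * g u * f u)"
proof (rule Sum_any.expand_superset)
  show "{u. ibinom N (int n - int u) * g u * f u \<noteq> 0} \<subseteq> {..n}"
    by (auto simp: ibinom_def split: if_splits)
qed simp

end

theory Submission
  imports Defs "HOL-Computational_Algebra.Polynomial" "HOL-Computational_Algebra.Primes"
begin

text \<open>Let \<open>P\<^sub>n(t)\<close> be the coefficient of \<open>y\<^sup>n\<close> in
  \<open>(ty / (e\<^bsup>ty\<^esup> - 1)) * ((e\<^sup>y - 1) / y)\<^sup>t\<close>. This is a polynomial in \<open>t\<close> of degree at most \<open>n\<close>, and it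
  vanishes for odd \<open>n\<close> because the series is even in \<open>y\<close>. The coefficients of \<open>((e\<^sup>y - 1) / y)\<^sup>t\<close>
  are Stirling numbers of the second kind for natural \<open>t\<close> and of the first kind for negative
  integers \<open>t\<close>, which gives \<open>\<B> x (x - n) = b x\<close> and \<open>\<A> x (x - n) = b (n - x)\<close> for the polynomial
  \<open>b x = n! (x gchoose n) P\<^sub>n(x - n)\<close> of degree at most \<open>2n\<close>. Both \<open>b x\<close> and \<open>b (n - x)\<close> vanish at
  \<open>0, \<dots>, n - 1\<close>, so the two duality formulas are their Lagrange interpolations at \<open>0, \<dots>, 2n\<close>.

  Integrality is shown one prime \<open>p\<close> at a time. Let \<open>G\<^sub>k = (e\<^sup>y - 1)\<^sup>k / k!\<close>. If \<open>p\<close> divides \<open>k\<close>, it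
  suffices that \<open>p B\<^sub>h\<close> is \<open>p\<close>-integral. Otherwise write \<open>(ky / (e\<^bsup>ky\<^esup> - 1)) G\<^sub>k\<close> as
  \<open>(pky / (e\<^bsup>pky\<^esup> - 1)) * (\<Sum>j<p. e\<^bsup>jky\<^esup>) G\<^sub>k / p\<close>. With \<open>Y = e\<^bsup>ky\<^esup> - 1\<close>, the sum over \<open>j\<close> is
  \<open>Y\<^bsup>p-1\<^esup>\<close> modulo \<open>p\<close>, and \<open>Y\<^bsup>p-1\<^esup> G\<^sub>k\<close> is an integral multiple of \<open>((k + p - 1)! / k!) G\<^bsub>k+p-1\<^esub>\<close>, hence
  divisible by \<open>p\<close>.\<close>

unbundle fps_syntax

section \<open>Polynomial functions\<close>

text \<open>Stated for functions, so that binomial coefficients and coefficients of power series get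
  degree bounds without a polynomial being named.\<close>

definition poly_fun :: "nat \<Rightarrow> (rat \<Rightarrow> rat) \<Rightarrow> bool" where
  "poly_fun n f \<longleftrightarrow> (\<exists>p. degree p \<le> n \<and> (\<forall>t. f t = poly p t))"

lemma poly_funI: "degree p \<le> n \<Longrightarrow> (\<And>t. f t = poly p t) \<Longrightarrow> poly_fun n f"
  by (auto simp: poly_fun_def)

lemma poly_fun_mono: "poly_fun m f \<Longrightarrow> m \<le> n \<Longrightarrow> poly_fun n f"
  by (auto simp: poly_fun_def intro: order_trans)

lemma poly_fun_const: "poly_fun n (\<lambda>t. c)"
  by (rule poly_funI [of "[:c:]"]) auto

lemma poly_fun_power: "poly_fun n (\<lambda>t. t ^ n)"
  by (rule poly_funI [of "monom 1 n"]) (auto simp: poly_monom degree_monom_le)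

lemma poly_fun_mult:
  assumes "poly_fun m f" "poly_fun n g"
  shows "poly_fun (m + n) (\<lambda>t. f t * g t)"
proof -
  from assms obtain p q where "degree p \<le> m" "\<And>t. f t = poly p t"
      and "degree q \<le> n" "\<And>t. g t = poly q t"
    by (auto simp: poly_fun_def)
  then show ?thesis
    by (intro poly_funI [of "p * q"]) (auto intro: order_trans [OF degree_mult_le])
qed

lemma poly_fun_sum:
  assumes "finite S" "\<And>i. i \<in> S \<Longrightarrow> poly_fun n (f i)"
  shows "poly_fun n (\<lambda>t. \<Sum>i\<in>S. f i t)"
proof -
  from assms(2) obtain p where "\<And>i. i \<in> S \<Longrightarrow> degree (p i) \<le> n \<and> (\<forall>t. f i t = poly (p i) t)"
    unfolding poly_fun_def by metis
  then show ?thesis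
    using assms(1) by (intro poly_funI [of "\<Sum>i\<in>S. p i"]) (auto simp: poly_sum intro: degree_sum_le)
qed

lemma poly_fun_affine:
  assumes "poly_fun n f"
  shows "poly_fun n (\<lambda>t. f (a + b * t))"
proof -
  from assms obtain p where p: "degree p \<le> n" "\<And>t. f t = poly p t"
    by (auto simp: poly_fun_def)
  have "degree (pcompose p [:a, b:]) \<le> n"
    using p(1) by (simp add: degree_pcompose)
  then show ?thesis
    by (rule poly_funI) (simp add: p poly_pcompose mult.commute)
qed

lemma poly_fun_gchoose: "poly_fun n (\<lambda>t. t gchoose n)"
proof -
  have "degree (\<Prod>i=0..<k. [:- of_nat i, 1:] :: rat poly) \<le> k" for k
    by (rule order_trans [OF degree_prod_sum_le]) simp_all
  then show ?thesis
    by (intro poly_funI [of "smult (1 / fact n) (\<Prod>i=0..<n. [:- of_nat i, 1:])"])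
       (auto simp: gbinomial_prod_rev poly_prod)
qed

lemma poly_fun_eqI:
  assumes "poly_fun n f" "poly_fun n g" "\<And>w. w \<le> n \<Longrightarrow> f (of_nat w) = g (of_nat w)"
  shows "f t = g t"
proof -
  from assms obtain p q where p: "degree p \<le> n" "\<And>t. f t = poly p t"
      and q: "degree q \<le> n" "\<And>t. g t = poly q t"
    by (auto simp: poly_fun_def)
  have "p = q"
  proof (rule poly_eqI_degree [of "of_nat ` {..n}"])
    show "poly p x = poly q x" if "x \<in> of_nat ` {..n}" for x
      using that assms(3) p(2) q(2) by auto
  qed (use p q in \<open>auto simp: card_image inj_on_def\<close>)
  with p q show ?thesis
    by simp
qed

text \<open>It suffices to compare both sides at \<open>0, ..., 2 * n\<close>. At
  \<open>n + v\<close> the first binomial coefficient vanishes for \<open>u < v\<close> and the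
  second for \<open>u > v\<close>; for \<open>u = v\<close> both are 1. Below \<open>n\<close> the
  second one always vanishes.\<close>

lemma gchoose_interpolation:
  assumes f: "poly_fun (2 * n) f" and zero: "\<And>w. w < n \<Longrightarrow> f (of_nat w) = 0"
  shows "f t = (\<Sum>u\<le>n. (2 * of_nat n - t gchoose (n - u)) * (t gchoose (n + u)) * f (of_nat (n + u)))"
    (is "_ = ?g t")
proof (rule poly_fun_eqI [OF f])
  show "poly_fun (2 * n) ?g"
  proof (intro poly_fun_sum)
    fix u assume "u \<in> {..n}"
    \<comment> \<open>One degree bound per factor; the \<open>0\<close> belongs to the constant
      \<open>f (of_nat (n + u))\<close>.\<close>
    then have "2 * n = (n - u) + (n + u) + 0"
      by simp
    then show "poly_fun (2 * n) (\<lambda>t. (2 * of_nat n - t gchoose (n - u)) * (t gchoose (n + u))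
                 * f (of_nat (n + u)))"
      using poly_fun_affine [OF poly_fun_gchoose, of "n - u" "2 * of_nat n" "-1"]
      by (simp only:) (intro poly_fun_mult poly_fun_gchoose poly_fun_const, simp)
  qed simp
next
  fix w assume w: "w \<le> 2 * n"
  show "f (of_nat w) = ?g (of_nat w)"
  proof (cases "w < n")
    case True
    then show ?thesis
      by (simp add: zero binomial_eq_0 flip: binomial_gbinomial)
  next
    case False
    then obtain v where v: "w = n + v" "v \<le> n"
      using w by (metis add_diff_inverse_nat le_diff_conv mult_2 add.commute add_le_cancel_left)
    have eq: "(2 * of_nat n - of_nat w :: rat) = of_nat (n - v)"
      using v by (simp add: of_nat_diff)
    have "?g (of_nat w) = (\<Sum>u\<le>n. if u = v then f (of_nat w) else 0)"
    proof (rule sum.cong, goal_cases)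
      case (2 u)
      consider "u = v" | "u < v" | "u > v" by linarith
      then show ?case
        unfolding eq
        by cases (use v 2 in \<open>simp_all add: binomial_eq_0 del: of_nat_add of_nat_diff
                                  flip: binomial_gbinomial\<close>)
    qed simp
    then show ?thesis
      using v by simp
  qed
qed


section \<open>Powers of $(e^y - 1) / y$ and Stirling numbers\<close>

definition exq :: "rat fps" where
  "exq = Abs_fps (\<lambda>n. 1 / fact (Suc n))"

lemma exq_mult_X: "exq * fps_X = fps_exp 1 - 1"
  by (rule fps_ext) (auto simp: exq_def simp del: fact_Suc split: nat.split)

lemma exq_nth_0 [simp]: "exq $ 0 = 1"
  by (simp add: exq_def)

text \<open>The binomial series \<open>(1 + z) ^ t\<close> at \<open>z = exq - 1\<close>. The
  composition is meaningful for every rational \<open>t\<close> because \<open>exq - 1\<close> has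
  constant term 0.\<close>

definition exq_powr :: "rat \<Rightarrow> rat fps" where
  "exq_powr t = fps_binomial t oo (exq - 1)"

lemma exq_powr_of_nat: "exq_powr (of_nat k) = exq ^ k"
  by (simp add: exq_powr_def fps_binomial_of_nat fps_compose_add_distrib flip: fps_compose_power)

lemma exq_powr_0 [simp]: "exq_powr 0 = 1"
  using exq_powr_of_nat [of 0] by simp

lemma exq_powr_nth_0 [simp]: "exq_powr t $ 0 = 1"
  by (simp add: exq_powr_def)

lemma exq_mult_exq_powr: "exq * exq_powr (t - 1) = exq_powr t"
proof -
  have "exq = fps_binomial 1 oo (exq - 1)"
    using exq_powr_of_nat [of 1] by (simp add: exq_powr_def)
  then have "exq * exq_powr (t - 1) = (fps_binomial 1 * fps_binomial (t - 1)) oo (exq - 1)"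
    by (simp add: exq_powr_def fps_compose_mult_distrib)
  then show ?thesis
    by (simp add: exq_powr_def flip: fps_binomial_add_mult)
qed

lemma poly_fun_exq_powr_nth: "poly_fun d (\<lambda>t. exq_powr t $ d)"
  unfolding exq_powr_def fps_compose_nth fps_binomial_nth
proof (rule poly_fun_sum)
  fix i assume "i \<in> {0..d}"
  then show "poly_fun d (\<lambda>t. (t gchoose i) * (exq - 1) ^ i $ d)"
    using poly_fun_mult [OF poly_fun_gchoose poly_fun_const, of i 0]
    by (auto intro: poly_fun_mono)
qed simp

lemma deriv_exq_powr: "fps_deriv (exq_powr t) = fps_const t * exq_powr (t - 1) * fps_deriv exq"
proof -
  have "fps_deriv (fps_binomial t) = fps_const t * fps_binomial (t - 1)"
    by (rule fps_ext) (use gbinomial_absorption in \<open>simp add: algebra_simps\<close>)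
  then show ?thesis
    by (simp add: exq_powr_def fps_compose_deriv fps_compose_mult_distrib)
qed

text \<open>Differentiating \<open>exq * y = e^y - 1\<close> gives
  \<open>y * exq' = y * exq + 1 - exq\<close>; this is inserted into the derivative of
  \<open>exq_powr t\<close>. The result specializes to the recurrences of both kinds of Stirling
  numbers.\<close>

lemma exq_powr_nth_Suc:
  "(of_nat (Suc d) + t) * exq_powr t $ Suc d = t * exq_powr t $ d + t * exq_powr (t - 1) $ Suc d"
proof -
  have "fps_deriv (exq * fps_X) = exq * fps_X + 1"
    by (simp add: exq_mult_X)
  then have "fps_X * fps_deriv exq = fps_X * exq + 1 - exq"
    by (simp add: algebra_simps)
  then have "fps_X * fps_deriv (exq_powr t) =
      fps_const t * exq_powr (t - 1) * (fps_X * exq + 1 - exq)"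
    by (metis deriv_exq_powr mult.left_commute)
  also have "\<dots> = fps_const t * (fps_X * exq_powr t + exq_powr (t - 1) - exq_powr t)"
    by (simp add: algebra_simps flip: exq_mult_exq_powr [of t])
  finally have "(fps_X * fps_deriv (exq_powr t)) $ Suc d = 
      (fps_const t * (fps_X * exq_powr t + exq_powr (t - 1) - exq_powr t)) $ Suc d"
    by simp
  then show ?thesis
    by (simp add: algebra_simps)
qed

text \<open>At \<open>t = Suc k\<close>, \<open>exq_powr_nth_Suc\<close> is the recurrence of the
  Stirling numbers of the second kind.\<close>

lemma fact_Stirling: "fact k * of_nat (Stirling (d + k) k) = fact (d + k) * exq_powr (of_nat k) $ d"
proof (induction k arbitrary: d)
  case 0
  then show ?case
    by (cases d) auto
next
  case (Suc k)
  note IH = Suc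
  show ?case
  proof (induction d)
    case (Suc d)
    have eq: "of_nat (Suc k) - 1 = (of_nat k :: rat)"
      by simp
    have "fact (Suc d + Suc k) * exq_powr (of_nat (Suc k)) $ Suc d
        = fact (d + Suc k) * ((of_nat (Suc d) + of_nat (Suc k)) * exq_powr (of_nat (Suc k)) $ Suc d)"
      by (simp add: algebra_simps)
    also have "\<dots> = of_nat (Suc k) * (fact (d + Suc k) * exq_powr (of_nat (Suc k)) $ d
                     + fact (Suc d + k) * exq_powr (of_nat k) $ Suc d)"
      unfolding exq_powr_nth_Suc eq by (simp add: algebra_simps)
    also have "\<dots> = of_nat (Suc k) * (fact (Suc k) * of_nat (Stirling (d + Suc k) (Suc k))
                     + fact k * of_nat (Stirling (Suc d + k) k))"
      by (simp only: Suc.IH IH)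
    also have "\<dots> = fact (Suc k) * of_nat (Stirling (Suc d + Suc k) (Suc k))"
      by (simp add: algebra_simps)
    finally show ?case
      by simp
  qed simp
qed

text \<open>Here \<open>exq_powr_nth_Suc\<close> is used at \<open>t = - of_nat (d + Suc m)\<close>.
  Writing the lower index as \<open>Suc m\<close> avoids a subtraction in its factorial
  \<open>fact m\<close>.\<close>

lemma fact_stirling:
  "fact m * of_nat (stirling (d + Suc m) (Suc m)) =
     (-1) ^ d * fact (d + m) * exq_powr (- of_nat (d + Suc m)) $ d"
proof (induction d arbitrary: m)
  case 0
  then show ?case by simp
next
  case (Suc d)
  note IH = Suc
  \<comment> \<open>The first summand is covered by the induction over \<open>d\<close>, the second
    by the induction over \<open>m\<close>; for \<open>m = 0\<close> the second vanishes.\<close>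
  have step: "(-1) ^ Suc d * fact (Suc d + m) * exq_powr (- of_nat (Suc d + Suc m)) $ Suc d
      = of_nat (d + Suc m) * ((-1) ^ d * fact (d + m) * exq_powr (- of_nat (d + Suc m)) $ d)
        + of_nat m * ((-1) ^ Suc d * fact (d + m) * exq_powr (- of_nat (d + Suc m)) $ Suc d)" for m
  proof -
    let ?n = "of_nat (d + Suc m) :: rat"
    have eq: "- ?n - 1 = - of_nat (Suc d + Suc m)" "of_nat (Suc d) + - ?n = - of_nat m"
        "fact (Suc d + m) = ?n * fact (d + m)"
      by (simp_all add: algebra_simps)
    have "?n * exq_powr (- of_nat (Suc d + Suc m)) $ Suc d
        = of_nat m * exq_powr (- ?n) $ Suc d - ?n * exq_powr (- ?n) $ d"
      using exq_powr_nth_Suc [of d "- ?n"] unfolding eq by (simp add: algebra_simps)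
    then show ?thesis
      unfolding eq(3) by (simp add: algebra_simps flip: distrib_left)
  qed
  show ?case
  proof (induction m)
    case 0
    show ?case
      unfolding step IH [symmetric] by (simp add: algebra_simps)
  next
    case (Suc m)
    have "(-1) ^ Suc d * fact (Suc d + Suc m) * exq_powr (- of_nat (Suc d + Suc (Suc m))) $ Suc d
      = of_nat (d + Suc (Suc m)) * (fact (Suc m) * of_nat (stirling (d + Suc (Suc m)) (Suc (Suc m))))
        + of_nat (Suc m) * (fact m * of_nat (stirling (Suc d + Suc m) (Suc m)))"
      unfolding IH Suc.IH using step [of "Suc m"] by (simp only: add_Suc add_Suc_right)
    also have "\<dots> = fact (Suc m) * of_nat (stirling (Suc d + Suc (Suc m)) (Suc (Suc m)))"
      by (simp add: algebra_simps)
    finally show ?case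
      by simp
  qed
qed


section \<open>The polynomials behind both families\<close>

text \<open>The series \<open>ty / (e^(ty) - 1)\<close>, given by coefficients so that
  \<open>t = 0\<close> is included, with value 1.\<close>

definition bern_fps :: "rat \<Rightarrow> rat fps" where
  "bern_fps t = Abs_fps (\<lambda>h. bernoulli h * t ^ h / fact h)"

lemma bern_fps_mult_exp: "bern_fps t * (fps_exp t - 1) = fps_const t * fps_X"
proof -
  have "bern_fps t = Abs_fps (\<lambda>h. bernoulli h / fact h) oo (fps_const t * fps_X)"
    by (rule fps_ext) (simp add: bern_fps_def)
  then have "(Abs_fps (\<lambda>h. bernoulli h / fact h) * (fps_exp 1 - 1)) oo (fps_const t * fps_X) =
      bern_fps t * (fps_exp t - 1)"
    by (simp add: fps_compose_mult_distrib fps_compose_sub_distrib)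
  then show ?thesis
    by (simp add: bernoulli_fps)
qed

lemma bernoulli_0 [simp]: "bernoulli 0 = 1"
  using arg_cong [OF bern_fps_mult_exp [of 1], of "\<lambda>f. f $ 1"]
  by (simp add: fps_mult_nth bern_fps_def)

lemma bern_fps_0 [simp]: "bern_fps 0 = 1"
  by (rule fps_ext) (simp add: bern_fps_def)

text \<open>Both sides agree after multiplication by \<open>fps_exp t - 1\<close>, which can be
  cancelled for nonzero \<open>t\<close>.\<close>

lemma bern_fps_uminus: "bern_fps (- t) = bern_fps t * fps_exp t"
proof (cases "t = 0")
  case False
  have "fps_exp t * fps_exp (- t) = 1"
    by (simp flip: fps_exp_add_mult)
  then have "bern_fps (- t) * (fps_exp t - 1) =
      - fps_exp t * (bern_fps (- t) * (fps_exp (- t) - 1))"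
    by (simp add: algebra_simps)
  also have "\<dots> = fps_exp t * (fps_const t * fps_X)"
    by (simp add: bern_fps_mult_exp flip: fps_const_neg)
  also have "\<dots> = bern_fps t * fps_exp t * (fps_exp t - 1)"
    by (subst bern_fps_mult_exp [symmetric]) (simp only: mult_ac)
  finally show ?thesis
    using False by simp
qed simp

lemma bern_fps_compose_uminus: "bern_fps t oo (- fps_X) = bern_fps (- t)"
  by (rule fps_ext) (simp add: fps_compose_uminus' bern_fps_def power_minus [of t])

lemma exq_compose_uminus: "(exq oo (- fps_X)) * fps_exp 1 = exq"
proof -
  have "(exq * fps_X) oo (- fps_X) = (fps_exp 1 - 1) oo (- fps_X)"
    by (simp only: exq_mult_X)
  then have *: "- (exq oo (- fps_X)) * fps_X = fps_exp (- 1) - 1"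
    using fps_exp_compose_linear [of 1 "-1 :: rat"]
    by (simp add: fps_compose_mult_distrib fps_compose_sub_distrib flip: fps_const_neg)
  have "(exq oo (- fps_X)) * fps_exp 1 * fps_X = - (- (exq oo (- fps_X)) * fps_X) * fps_exp 1"
    by (simp add: mult_ac)
  also have "\<dots> = - (fps_exp (- 1) - 1) * fps_exp 1"
    by (simp only: *)
  also have "\<dots> = exq * fps_X"
    unfolding exq_mult_X by (simp add: algebra_simps flip: fps_exp_add_mult)
  finally show ?thesis
    by simp
qed

text \<open>This is \<open>P\<^sub>n(t)\<close> of the introduction.\<close>

definition stirl_poly :: "nat \<Rightarrow> rat \<Rightarrow> rat" where
  "stirl_poly n t = (bern_fps t * exq_powr t) $ n"

lemma stirl_poly_sum:
  "stirl_poly n t = (\<Sum>h\<le>n. bernoulli h * t ^ h / fact h * exq_powr t $ (n - h))"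
  by (simp add: stirl_poly_def fps_mult_nth bern_fps_def atLeast0AtMost)

lemma poly_fun_stirl_poly: "poly_fun n (stirl_poly n)"
  unfolding stirl_poly_sum [abs_def]
proof (rule poly_fun_sum)
  fix h assume "h \<in> {..n}"
  then have "poly_fun n (\<lambda>t. bernoulli h * t ^ h * inverse (fact h) * exq_powr t $ (n - h)) \<longleftrightarrow>
      poly_fun (0 + h + 0 + (n - h)) (\<lambda>t. bernoulli h * t ^ h * inverse (fact h) * exq_powr t $ (n - h))"
    by simp
  also have \<dots>
    by (intro poly_fun_mult poly_fun_const poly_fun_power poly_fun_exq_powr_nth)
  finally show "poly_fun n (\<lambda>t. bernoulli h * t ^ h / fact h * exq_powr t $ (n - h))"
    by (simp only: divide_inverse)
qed simp

lemma stirl_poly_0_right: "stirl_poly n 0 = (if n = 0 then 1 else 0)"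
  by (simp add: stirl_poly_def)

text \<open>A polynomial is determined by its values at natural \<open>t\<close>, and there
  \<open>exq_powr t\<close> is an ordinary power.\<close>

lemma stirl_poly_odd:
  assumes "odd n"
  shows "stirl_poly n t = 0"
proof (rule poly_fun_eqI [OF poly_fun_stirl_poly poly_fun_const])
  fix k :: nat
  let ?f = "bern_fps (of_nat k) * exq ^ k"
  \<comment> \<open>Both factors pick up an exponential under \<open>y \<mapsto> - y\<close>, and these cancel.\<close>
  have "?f oo (- fps_X) = bern_fps (of_nat k) * (fps_exp 1 ^ k * (exq oo (- fps_X)) ^ k)"
    by (simp add: fps_compose_mult_distrib bern_fps_compose_uminus bern_fps_uminus
        fps_exp_power_mult mult_ac flip: fps_compose_power)
  also have "\<dots> = ?f"
    by (simp only: power_mult_distrib [symmetric] mult.commute [of "fps_exp 1"] exq_compose_uminus)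
  finally have "(?f oo (- fps_X)) $ n = ?f $ n"
    by simp
  with assms show "stirl_poly n (of_nat k) = 0"
    by (simp add: stirl_poly_def exq_powr_of_nat fps_compose_uminus')
qed

definition stirlB_poly :: "nat \<Rightarrow> rat \<Rightarrow> rat" where
  "stirlB_poly n w = fact n * (w gchoose n) * stirl_poly n (w - of_nat n)"

text \<open>This is \<open>b (n - w)\<close> of the introduction. Negating the upper index of the
  binomial coefficient costs a sign \<open>(-1) ^ n\<close>, which is dropped because
  \<open>stirl_poly n\<close> vanishes for odd \<open>n\<close>.\<close>

definition stirlA_poly :: "nat \<Rightarrow> rat \<Rightarrow> rat" where
  "stirlA_poly n w = fact n * (w - 1 gchoose n) * stirl_poly n (- w)"

lemma stirlB_eq_poly: "\<B> (n + k) k = stirlB_poly n (of_nat (n + k))"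
proof -
  have "\<B> (n + k) k = (\<Sum>h\<le>n. bernoulli h * ibinom (int (n + k)) (int h)
          * of_nat (Stirling (n + k - h) k) * of_nat k ^ h)"
    \<comment> \<open>For \<open>h > n\<close> the upper index \<open>n + k - h\<close> is below
      \<open>k\<close>, so the Stirling number is 0.\<close>
    unfolding stirlB_finite_sum by (rule sum.mono_neutral_right) auto
  also have "\<dots> = (\<Sum>h\<le>n. fact (n + k) / fact k * (bernoulli h * of_nat k ^ h / fact h
                      * exq_powr (of_nat k) $ (n - h)))"
  proof (rule sum.cong)
    fix h assume "h \<in> {..n}"
    then have h: "h \<le> n" by simp
    have "ibinom (int (n + k)) (int h) = of_nat ((n + k) choose h)"
      by (simp add: ibinom_def binomial_gbinomial)
    also have "\<dots> = fact (n + k) / (fact h * fact (n + k - h))"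
      using h by (simp add: binomial_fact)
    finally have 1: "ibinom (int (n + k)) (int h) = fact (n + k) / (fact h * fact (n + k - h))" .
    have 2: "of_nat (Stirling (n + k - h) k) =
        fact (n + k - h) * exq_powr (of_nat k) $ (n - h) / fact k"
      using fact_Stirling [of k "n - h"] h by (simp add: field_simps)
    show "bernoulli h * ibinom (int (n + k)) (int h) * of_nat (Stirling (n + k - h) k) * of_nat k ^ h
        = fact (n + k) / fact k * (bernoulli h * of_nat k ^ h / fact h
                      * exq_powr (of_nat k) $ (n - h))"
      unfolding 1 2 by (simp add: mult_ac)
  qed simp
  also have "\<dots> = fact (n + k) / fact k * stirl_poly n (of_nat k)"
    by (simp only: stirl_poly_sum sum_distrib_left)
  also have "fact (n + k) / fact k = fact n * (of_nat (n + k) gchoose n :: rat)"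
    by (simp add: binomial_fact flip: binomial_gbinomial del: of_nat_add)
  finally show ?thesis
    by (simp add: stirlB_poly_def)
qed

lemma stirlA_eq_poly: "\<A> (n + k) k = stirlA_poly n (of_nat (n + k))"
proof (cases k)
  \<comment> \<open>\<open>fact_stirling\<close> requires a positive lower index. For
    \<open>k = 0\<close> the binomial coefficient of \<open>h - 1\<close> over \<open>h\<close>
    vanishes unless \<open>h = 0\<close>, so only \<open>stirling n 0\<close> remains.\<close>
  case 0
  have "\<A> n 0 = (\<Sum>h\<le>n. if h = 0 then of_nat (stirling n 0) else 0)"
    unfolding stirlA_finite_sum
  proof (rule sum.cong)
    fix h
    have "ibinom (int 0 + int h - 1) (int h) = 0" if "h \<noteq> 0"
    proof -
      have "(of_int (int 0 + int h - 1) :: rat) = of_nat (h - 1)"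
        using that by (simp add: of_nat_diff)
      then show ?thesis
        using that by (simp add: ibinom_def binomial_eq_0 del: of_nat_diff flip: binomial_gbinomial)
    qed
    then show "bernoulli h * ibinom (int 0 + int h - 1) (int h) * of_nat (stirling n (h + 0))
          * of_nat n ^ h = (if h = 0 then of_nat (stirling n 0) else 0)"
      by (auto simp: ibinom_def)
  qed simp
  also have "\<dots> = of_nat (stirling n 0)"
    by simp
  also have "\<dots> = stirlA_poly n (of_nat n)"
  proof (cases n)
    case (Suc m)
    have "(of_nat n - 1 :: rat) = of_nat m"
      by (simp add: Suc)
    then have "(of_nat n - 1 gchoose n :: rat) = 0"
      using Suc by (simp flip: binomial_gbinomial)
    then show ?thesis
      using Suc by (simp add: stirlA_poly_def)
  qed (simp add: stirlA_poly_def stirl_poly_0_right)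
  finally show ?thesis
    using 0 by simp
next
  case (Suc m)
  let ?n = "of_nat (n + k) :: rat"
  have "\<A> (n + k) k = (\<Sum>h\<le>n. bernoulli h * ibinom (int k + int h - 1) (int h)
          * of_nat (stirling (n + k) (h + k)) * of_nat (n + k) ^ h)"
    unfolding stirlA_finite_sum by (rule sum.mono_neutral_right) auto
  also have "\<dots> = (\<Sum>h\<le>n. fact (n + m) / fact m * ((-1) ^ n * (bernoulli h * (- ?n) ^ h / fact h
                      * exq_powr (- ?n) $ (n - h))))"
  proof (rule sum.cong)
    fix h assume "h \<in> {..n}"
    then have h: "h \<le> n" by simp
    have "ibinom (int k + int h - 1) (int h) = of_nat ((h + m) choose h)"
      by (simp add: ibinom_def binomial_gbinomial Suc add.commute)
    also have "\<dots> = fact (h + m) / (fact h * fact m)"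
      by (simp add: binomial_fact)
    finally have 1: "ibinom (int k + int h - 1) (int h) = fact (h + m) / (fact h * fact m)" .
    have eq: "n - h + Suc (h + m) = n + k" "n - h + (h + m) = n + m"
      using h Suc by auto
    have 2: "of_nat (stirling (n + k) (h + k)) =
        (-1) ^ (n - h) * fact (n + m) * exq_powr (- ?n) $ (n - h) / fact (h + m)"
      using fact_stirling [of "h + m" "n - h"] h unfolding eq
      by (simp add: field_simps Suc)
    \<comment> \<open>The sign from \<open>fact_stirling\<close> turns the base \<open>?n\<close>
      into \<open>- ?n\<close>, at the cost of a global \<open>(-1) ^ n\<close>.\<close>
    have "(-1 :: rat) ^ n = (-1) ^ h * (-1) ^ (n - h)"
      using h by (simp flip: power_add)
    then have 3: "(-1) ^ (n - h) * ?n ^ h = (-1) ^ n * (- ?n) ^ h"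
      by (simp add: power_minus [of ?n] mult_ac del: of_nat_add)
    have "bernoulli h * ibinom (int k + int h - 1) (int h) * of_nat (stirling (n + k) (h + k)) * ?n ^ h
        = fact (n + m) / fact m * (bernoulli h * ((-1) ^ (n - h) * ?n ^ h) / fact h
                      * exq_powr (- ?n) $ (n - h))"
      unfolding 1 2 by (simp add: mult_ac del: of_nat_add)
    then show "bernoulli h * ibinom (int k + int h - 1) (int h) * of_nat (stirling (n + k) (h + k)) * ?n ^ h
        = fact (n + m) / fact m * ((-1) ^ n * (bernoulli h * (- ?n) ^ h / fact h
                      * exq_powr (- ?n) $ (n - h)))"
      unfolding 3 by (simp add: mult_ac del: of_nat_add)
  qed simp
  also have "\<dots> = fact (n + m) / fact m * ((-1) ^ n * stirl_poly n (- ?n))"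
    by (simp only: stirl_poly_sum sum_distrib_left)
  also have "(-1) ^ n * stirl_poly n (- ?n) = stirl_poly n (- ?n)"
    by (cases "odd n") (simp_all add: stirl_poly_odd)
  also have "fact (n + m) / fact m = fact n * (?n - 1 gchoose n)"
  proof -
    have "?n - 1 = of_nat (n + m)"
      by (simp add: Suc)
    then show ?thesis
      by (simp add: binomial_fact flip: binomial_gbinomial del: of_nat_add)
  qed
  finally show ?thesis
    by (simp add: stirlA_poly_def)
qed

text \<open>Both sides evaluate \<open>stirl_poly n\<close> at \<open>w - n\<close>. The binomial
  coefficients agree for even \<open>n\<close> by negation of the upper index, and for odd
  \<open>n\<close> both sides are 0.\<close>

lemma stirlA_poly_reflect: "stirlA_poly n (of_nat n - w) = stirlB_poly n w"
proof (cases "odd n")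
  case False
  have "(w gchoose n) = (of_nat n - w - 1 gchoose n)"
    using gbinomial_negated_upper [of w n] False by simp
  then show ?thesis
    by (simp add: stirlA_poly_def stirlB_poly_def)
qed (simp add: stirlA_poly_def stirlB_poly_def stirl_poly_odd)

section \<open>Degrees and zeros of the two polynomials, and interpolation\<close>

lemma poly_fun_stirlB_poly: "poly_fun (2 * n) (stirlB_poly n)"
proof -
  have "poly_fun (0 + n + n) (\<lambda>w. fact n * (w gchoose n) * stirl_poly n (- of_nat n + 1 * w))"
    by (intro poly_fun_mult poly_fun_const poly_fun_gchoose poly_fun_affine poly_fun_stirl_poly)
  then show ?thesis
    by (simp add: stirlB_poly_def [abs_def] mult_2)
qed

lemma poly_fun_stirlA_poly: "poly_fun (2 * n) (stirlA_poly n)"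
  using poly_fun_affine [OF poly_fun_stirlB_poly, of n "of_nat n" "-1"]
  by (simp add: stirlA_poly_reflect [symmetric])

lemma stirlB_poly_small: "w < n \<Longrightarrow> stirlB_poly n (of_nat w) = 0"
  by (simp add: stirlB_poly_def flip: binomial_gbinomial)

text \<open>For positive \<open>w\<close> the binomial coefficient of \<open>w - 1\<close> over
  \<open>n\<close> is 0. At \<open>w = 0\<close> it is not, but there
  \<open>stirl_poly n 0 = 0\<close> since \<open>n > 0\<close>.\<close>

lemma stirlA_poly_small:
  assumes "w < n"
  shows "stirlA_poly n (of_nat w) = 0"
proof (cases w)
  case (Suc m)
  then have "(of_nat w - 1 :: rat) = of_nat m"
    by simp
  then show ?thesis
    using Suc assms by (simp add: stirlA_poly_def flip: binomial_gbinomial)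
qed (use assms in \<open>simp add: stirlA_poly_def stirl_poly_0_right\<close>)

text \<open>This is \<open>gchoose_interpolation\<close> at \<open>t = n - x\<close>, where
  \<open>2 * n - t = n + x\<close>.\<close>

lemma ibinom_interpolation:
  assumes "poly_fun (2 * n) f" "\<And>w. w < n \<Longrightarrow> f (of_nat w) = 0"
  shows "f (of_nat n - of_nat x) = Sum_any (\<lambda>u. ibinom (int n + int x) (int n - int u)
            * ibinom (int n - int x) (int n + int u) * f (of_nat (n + u)))"
proof -
  have "(2 * of_nat n - (of_nat n - of_nat x) gchoose (n - u)) * (of_nat n - of_nat x gchoose (n + u)) =
      ibinom (int n + int x) (int n - int u) * ibinom (int n - int x) (int n + int u)"
    if "u \<le> n" for u
    using that by (simp add: ibinom_def nat_diff_distrib nat_add_distrib)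
  moreover have "f (of_nat n - of_nat x) = (\<Sum>u\<le>n. (2 * of_nat n - (of_nat n - of_nat x) gchoose (n - u))
      * (of_nat n - of_nat x gchoose (n + u)) * f (of_nat (n + u)))"
    using assms by (rule gchoose_interpolation)
  ultimately show ?thesis
    unfolding ibinom_Sum_any_finite_sum by simp
qed

section \<open>The duality formulas and the parity statement\<close>

lemma stirlB_duality:
  assumes "n \<le> x"
  shows "\<B> x (x - n) = Sum_any (\<lambda>u. ibinom (int n + int x) (int n - int u)
                          * ibinom (int n - int x) (int n + int u) * \<A> (n + u) u)"
proof -
  have "\<B> x (x - n) = stirlA_poly n (of_nat n - of_nat x)"
    using stirlB_eq_poly [of n "x - n"] assms by (simp add: stirlA_poly_reflect)
  then show ?thesis
    by (simp only: ibinom_interpolation [OF poly_fun_stirlA_poly stirlA_poly_small] stirlA_eq_poly)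
qed

lemma stirlA_duality:
  assumes "n \<le> x"
  shows "\<A> x (x - n) = Sum_any (\<lambda>u. ibinom (int n + int x) (int n - int u)
                          * ibinom (int n - int x) (int n + int u) * \<B> (n + u) u)"
proof -
  have "\<A> x (x - n) = stirlB_poly n (of_nat n - of_nat x)"
    using stirlA_eq_poly [of n "x - n"] assms by (simp flip: stirlA_poly_reflect)
  then show ?thesis
    by (simp only: ibinom_interpolation [OF poly_fun_stirlB_poly stirlB_poly_small] stirlB_eq_poly)
qed

lemma stirlB_less: "n < k \<Longrightarrow> \<B> n k = 0"
  unfolding stirlB_finite_sum by (rule sum.neutral) auto

lemma stirlB_odd:
  assumes "odd (int n - int k)"
  shows "\<B> n k = 0"
proof (cases "n < k")
  case False
  then obtain d where "n = d + k"
    by (metis add.commute le_Suc_ex not_less)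
  with assms show ?thesis
    by (simp add: stirlB_eq_poly stirlB_poly_def stirl_poly_odd)
qed (simp add: stirlB_less)


section \<open>Integrality\<close>

text \<open>For prime \<open>p\<close>, the localization of the integers at
  \<open>p\<close>.\<close>

definition local_int :: "nat \<Rightarrow> rat \<Rightarrow> bool" where
  "local_int p r \<longleftrightarrow> (\<exists>a b. \<not> int p dvd b \<and> r = of_int a / of_int b)"

text \<open>A prime dividing the reduced denominator would also divide the numerator.\<close>

lemma Ints_if_local_int:
  assumes "\<And>p. prime p \<Longrightarrow> local_int p r"
  shows "r \<in> \<int>"
proof -
  obtain a b where ab: "quotient_of r = (a, b)"
    by fastforce
  then have b: "b > 0" "coprime a b" and r: "r = of_int a / of_int b"
    using quotient_of_denom_pos quotient_of_coprime quotient_of_div by blast+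
  have "b = 1"
  proof (rule ccontr)
    assume "b \<noteq> 1"
    with b(1) have "nat b \<noteq> 1"
      by auto
    then obtain p where p: "prime p" "p dvd nat b"
      using prime_factor_nat by blast
    then have pb: "int p dvd b"
      using b(1) by (metis int_dvd_int_iff nat_0_le order_less_imp_le)
    from assms [OF p(1)] obtain c d where cd: "\<not> int p dvd d" "r = of_int c / of_int d"
      by (auto simp: local_int_def)
    then have "d \<noteq> 0"
      by auto
    then have "(of_int (a * d) :: rat) = of_int (c * b)"
      using r cd(2) b(1) by (simp add: field_simps)
    then have "a * d = c * b"
      by (simp only: of_int_eq_iff)
    then have "int p dvd a * d"
      using pb by simp
    then have "int p dvd a"
      using cd(1) p(1) prime_dvd_mult_iff [of "int p"] by auto
    then have "int p dvd 1"
      using pb b(2) by (meson coprime_common_divisor)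
    then show False
      using p(1) by auto
  qed
  then show ?thesis
    using r by simp
qed

definition local_egf :: "nat \<Rightarrow> rat fps \<Rightarrow> bool" where
  "local_egf p f \<longleftrightarrow> (\<forall>n. local_int p (fact n * f $ n))"

context
  fixes p :: nat
  assumes p: "prime p"
begin

section \<open>Closure properties of \<open>p\<close>-integral numbers and exponential generating
  functions\<close>

lemma local_int_of_int [simp, intro]: "local_int p (of_int a)"
  unfolding local_int_def using p by (intro exI [of _ a] exI [of _ 1]) auto

lemma local_int_mult:
  assumes "local_int p r" "local_int p s"
  shows "local_int p (r * s)"
proof -
  from assms obtain a b c d where "\<not> int p dvd b" "r = of_int a / of_int b"
      "\<not> int p dvd d" "s = of_int c / of_int d"
    by (auto simp: local_int_def)
  then show ?thesis
    unfolding local_int_def using p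
    by (intro exI [of _ "a * c"] exI [of _ "b * d"]) (auto simp: prime_dvd_mult_iff)
qed

lemma local_int_add:
  assumes "local_int p r" "local_int p s"
  shows "local_int p (r + s)"
proof -
  from assms obtain a b c d where *: "\<not> int p dvd b" "r = of_int a / of_int b"
      "\<not> int p dvd d" "s = of_int c / of_int d"
    by (auto simp: local_int_def)
  then have "b \<noteq> 0" "d \<noteq> 0"
    by auto
  with * show ?thesis
    unfolding local_int_def using p
    by (intro exI [of _ "a * d + c * b"] exI [of _ "b * d"])
       (auto simp: prime_dvd_mult_iff field_simps)
qed

lemma local_int_minus: "local_int p r \<Longrightarrow> local_int p (- r)"
  using local_int_mult [OF local_int_of_int [of "-1"]] by simp

lemma local_int_sum: "(\<And>i. i \<in> S \<Longrightarrow> local_int p (f i)) \<Longrightarrow> local_int p (sum f S)"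
proof (induction S rule: infinite_finite_induct)
  case (insert i S)
  then show ?case
    by (simp add: local_int_add)
qed (use local_int_of_int [of 0] in simp_all)

text \<open>If \<open>p ^ v\<close> is the exact power of \<open>p\<close> in \<open>Suc j\<close>,
  then \<open>p ^ v \<le> Suc j \<le> 2 ^ j \<le> p ^ j\<close>, so
  \<open>v \<le> j\<close>.\<close>

lemma local_int_power_div_Suc: "local_int p (of_nat p ^ j / of_nat (Suc j))"
proof -
  obtain m where m: "Suc j = p ^ multiplicity p (Suc j) * m" "\<not> p dvd m"
    by (rule multiplicity_decompose' [of "Suc j" p]) (use p in auto)
  define v where "v = multiplicity p (Suc j)"
  have "m > 0"
    using m(2) by (cases m) auto
  have "p ^ v \<le> Suc j"
    using m(1) \<open>m > 0\<close> unfolding v_def by (metis Suc_leI dvd_imp_le dvd_triv_left zero_less_Suc)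
  also have "\<dots> \<le> 2 ^ j"
    by (intro Suc_leI less_exp)
  also have "\<dots> \<le> p ^ j"
    using prime_ge_2_nat [OF p] by (simp add: power_mono)
  finally have "v \<le> j"
    using prime_gt_1_nat [OF p] by simp
  then have "(of_nat p ^ j :: rat) = of_nat p ^ v * of_nat p ^ (j - v)"
    by (simp flip: power_add)
  moreover have "(of_nat (Suc j) :: rat) = of_nat p ^ v * of_nat m"
    using m(1) unfolding v_def by (metis of_nat_mult of_nat_power)
  ultimately have "of_nat p ^ j / of_nat (Suc j) = (of_nat p ^ (j - v) / of_nat m :: rat)"
    using prime_gt_0_nat [OF p] by simp
  then show ?thesis
    unfolding local_int_def using m(2)
    by (intro exI [of _ "int p ^ (j - v)"] exI [of _ "int m"]) simp
qed

lemma local_egf_const: "local_int p c \<Longrightarrow> local_egf p (fps_const c)"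
  using local_int_of_int [of 0] by (auto simp: local_egf_def)

text \<open>Products of exponential generating functions are binomial convolutions, whose weights
  are integers.\<close>

lemma local_egf_mult:
  assumes "local_egf p f" "local_egf p g"
  shows "local_egf p (f * g)"
  unfolding local_egf_def
proof
  fix n
  have "fact n * (f * g) $ n =
      (\<Sum>i=0..n. of_int (int (n choose i)) * ((fact i * f $ i) * (fact (n - i) * g $ (n - i))))"
    unfolding fps_mult_nth sum_distrib_left
    by (intro sum.cong) (simp_all add: binomial_fact)
  also have "local_int p \<dots>"
    using assms unfolding local_egf_def
    by (intro local_int_sum local_int_mult [OF local_int_of_int] local_int_mult [of "fact i * c" for i c]) auto
  finally show "local_int p (fact n * (f * g) $ n)" .
qed

lemma local_egf_sum: "(\<And>i. i \<in> S \<Longrightarrow> local_egf p (f i)) \<Longrightarrow> local_egf p (sum f S)"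
  unfolding local_egf_def fps_sum_nth sum_distrib_left by (auto intro: local_int_sum)

lemma local_egf_add: "local_egf p f \<Longrightarrow> local_egf p g \<Longrightarrow> local_egf p (f + g)"
  by (auto simp: local_egf_def distrib_left intro: local_int_add)

lemma local_egf_of_nat: "local_egf p (of_nat c)"
  using local_egf_const [OF local_int_of_int [of "int c"]] by (simp add: fps_of_nat)

lemma local_egf_power: "local_egf p f \<Longrightarrow> local_egf p (f ^ n)"
  using local_egf_of_nat [of 1]
  by (induction n) (auto intro: local_egf_mult)

lemma local_egf_exp: "local_egf p (fps_exp (of_nat a))"
  using local_int_of_int [of "int a ^ n" for n] by (simp add: local_egf_def)

text \<open>Expanding \<open>\<Sum>i<p. e\<^sup>i\<^sup>y = (y / (e\<^sup>y - 1)) * ((e\<^sup>p\<^sup>y - 1) / y)\<close> expresses \<open>p B\<^sub>n\<close> through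
  the earlier \<open>p B\<^sub>h\<close> with coefficients that contain \<open>p\<^sup>j / (j + 1)\<close>.\<close>

lemma local_int_bernoulli: "local_int p (of_nat p * bernoulli n)"
proof (induction n rule: less_induct)
  case (less n)
  define D :: "rat fps" where "D = Abs_fps (\<lambda>j. of_nat p ^ Suc j / fact (Suc j))"
  have D: "D * fps_X = fps_exp (of_nat p) - 1"
    by (rule fps_ext) (auto simp: D_def simp del: fact_Suc power_Suc split: nat.split)
  define S :: "rat fps" where "S = (\<Sum>i<p. fps_exp (of_nat i))"
  have S: "fps_exp (of_nat p) - 1 = (fps_exp 1 - 1) * S"
    using power_diff_1_eq [of "fps_exp (1 :: rat)" p] by (simp add: S_def fps_exp_power_mult)
  have "bern_fps 1 * D * fps_X = (bern_fps 1 * (fps_exp 1 - 1)) * S"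
    by (simp only: mult.assoc D S)
  also have "\<dots> = S * fps_X"
    by (simp add: bern_fps_mult_exp)
  finally have "bern_fps 1 * D = S"
    by simp
  then have "fact n * S $ n = (\<Sum>h=0..n. fact n * (bern_fps 1 $ h * D $ (n - h)))"
    by (auto simp: fps_mult_nth sum_distrib_left)
  also have "\<dots> = (\<Sum>h=0..n. of_int (int (n choose h)) * (of_nat p * bernoulli h)
                      * (of_nat p ^ (n - h) / of_nat (Suc (n - h))))"
    by (intro sum.cong) (simp_all add: bern_fps_def D_def binomial_fact mult_ac)
  \<comment> \<open>The term \<open>h = n\<close> is exactly \<open>of_nat p * bernoulli n\<close>
    and is isolated.\<close>
  also have "{0..n} = insert n {..<n}"
    by auto
  finally have eq: "of_nat p * bernoulli n = fact n * S $ n -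
      (\<Sum>h<n. of_int (int (n choose h)) * (of_nat p * bernoulli h)
                      * (of_nat p ^ (n - h) / of_nat (Suc (n - h))))"
    by simp
  have "local_egf p S"
    unfolding S_def by (intro local_egf_sum local_egf_exp)
  then have "local_int p (fact n * S $ n)"
    by (simp add: local_egf_def)
  moreover have "local_int p (\<Sum>h<n. of_int (int (n choose h)) * (of_nat p * bernoulli h)
                      * (of_nat p ^ (n - h) / of_nat (Suc (n - h))))"
    by (intro local_int_sum
          local_int_mult [OF local_int_mult [OF local_int_of_int less] local_int_power_div_Suc]) simp
  ultimately show ?case
    unfolding eq diff_conv_add_uminus by (intro local_int_add local_int_minus)
qed

text \<open>For \<open>n > 0\<close>, one factor \<open>p\<close> of \<open>k ^ n\<close> makes
  \<open>bernoulli n\<close> \<open>p\<close>-integral; for \<open>n = 0\<close> the coefficient is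
  1.\<close>

lemma local_egf_bern_fps:
  assumes "p dvd k"
  shows "local_egf p (bern_fps (of_nat k))"
  unfolding local_egf_def
proof
  fix n
  from assms obtain m where m: "k = p * m" ..
  show "local_int p (fact n * bern_fps (of_nat k) $ n)"
  proof (cases n)
    case 0
    then show ?thesis
      using local_int_of_int [of 1] by (simp add: bern_fps_def)
  next
    case (Suc i)
    have "fact n * bern_fps (of_nat k) $ n = (of_nat p * bernoulli n) * of_int (int (m * k ^ i))"
      by (simp add: bern_fps_def Suc m algebra_simps del: fact_Suc)
    then show ?thesis
      by (simp only: local_int_mult local_int_bernoulli local_int_of_int)
  qed
qed

end

text \<open>The series \<open>G\<^sub>k\<close> of the introduction, defined by its coefficients so
  that its integrality is immediate.\<close>

definition Stirling_egf :: "nat \<Rightarrow> rat fps" where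
  "Stirling_egf k = Abs_fps (\<lambda>n. of_nat (Stirling n k) / fact n)"

lemma fact_mult_Stirling_egf: "fps_const (fact k) * Stirling_egf k = (fps_exp 1 - 1) ^ k"
proof (rule fps_ext)
  fix n
  have "(fps_exp 1 - 1) ^ k = fps_X ^ k * exq_powr (of_nat k)"
    by (simp add: exq_powr_of_nat exq_mult_X [symmetric] power_mult_distrib mult.commute)
  then show "(fps_const (fact k) * Stirling_egf k) $ n = (fps_exp 1 - 1) ^ k $ n"
    using fact_Stirling [of k "n - k"]
    by (auto simp: Stirling_egf_def fps_X_power_mult_nth field_simps)
qed

lemma local_egf_Stirling_egf: "prime p \<Longrightarrow> local_egf p (Stirling_egf k)"
  using local_int_of_int [of p "int m" for m] by (auto simp: local_egf_def Stirling_egf_def)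

lemma stirlB_egf: "\<B> n k = fact n * (bern_fps (of_nat k) * Stirling_egf k) $ n"
proof -
  have "ibinom (int n) (int h) = fact n / (fact h * fact (n - h))" if "h \<le> n" for h
    using that by (simp add: ibinom_def binomial_fact flip: binomial_gbinomial)
  then show ?thesis
    unfolding stirlB_finite_sum fps_mult_nth sum_distrib_left atLeast0AtMost
    by (intro sum.cong) (simp_all add: bern_fps_def Stirling_egf_def)
qed

text \<open>As \<open>p\<close> does not divide \<open>k\<close>, the next multiple of
  \<open>p\<close> above \<open>k\<close> is at most \<open>k + p - 1\<close> and is thus a factor
  of the quotient.\<close>

lemma prime_dvd_fact_quotient:
  assumes "prime p" "\<not> p dvd k"
  shows "\<exists>c. (fact (k + p - 1) :: nat) = p * c * fact k"
proof -
  have "k mod p > 0"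
    using assms(2) by (simp add: dvd_eq_mod_eq_0)
  obtain q where q: "k < p * Suc q" "p * Suc q \<le> k + p - 1"
  proof
    have "p > 0"
      using assms(1) prime_gt_0_nat by blast
    have *: "k = p * (k div p) + k mod p"
      by simp
    show "k < p * Suc (k div p)"
      using \<open>p > 0\<close> by (simp add: dividend_less_times_div)
    show "p * Suc (k div p) \<le> k + p - 1"
      using * \<open>k mod p > 0\<close> unfolding mult_Suc_right by linarith
  qed
  have "fact (k + p - 1) = fact k * \<Prod>{k + 1..k + p - 1}"
    using q fact_eq_fact_times [of k "k + p - 1"] by simp
  moreover have "p dvd \<Prod>{k + 1..k + p - 1}"
    using q by (intro dvd_trans [OF _ dvd_prodI [of _ "p * Suc q"]]) auto
  ultimately show ?thesis
    by auto
qed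

lemma local_int_stirlB:
  assumes p: "prime p"
  shows "local_int p (\<B> n k)"
proof -
  note [intro] = local_egf_mult [OF p] local_egf_power [OF p] local_egf_sum [OF p]
    local_egf_Stirling_egf [OF p] local_egf_bern_fps [OF p] local_egf_exp [OF p]
    local_egf_of_nat [OF p] local_egf_add [OF p]
  let ?k = "of_nat k :: rat" and ?G = "Stirling_egf k"
  have "local_egf p (bern_fps ?k * ?G)"
  \<comment> \<open>If \<open>p\<close> divides \<open>k\<close>, both factors are
    \<open>p\<close>-integral; the final \<open>auto\<close> settles this case.\<close>
  proof (cases "p dvd k")
    case False
    then have "k > 0"
      by (cases k) auto
    have p0: "p > 0"
      using p prime_gt_0_nat by blast
    let ?Y = "fps_exp ?k - 1 :: rat fps"
    define S where "S = (\<Sum>j<p. fps_exp ?k ^ j)"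
    \<comment> \<open>\<open>W\<close> is the integral cofactor of \<open>e^y - 1\<close> in
      \<open>?Y\<close>.\<close>
    define W :: "rat fps" where "W = (\<Sum>j<k. fps_exp (of_nat j))"
    define b where "b = bern_fps (of_nat (p * k))"
    have S: "fps_exp (of_nat (p * k)) - 1 = ?Y * S"
      using power_diff_1_eq [of "fps_exp ?k" p] by (simp add: S_def fps_exp_power_mult)
    have W: "?Y = (fps_exp 1 - 1) * W"
      using power_diff_1_eq [of "fps_exp (1 :: rat)" k] by (simp add: W_def fps_exp_power_mult)
    have Y0: "?Y \<noteq> 0"
      using \<open>k > 0\<close> by simp
    have "of_nat p * bern_fps ?k * ?Y = of_nat p * (fps_const ?k * fps_X)"
      by (simp only: mult.assoc bern_fps_mult_exp)
    also have "\<dots> = b * (fps_exp (of_nat (p * k)) - 1)"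
      unfolding b_def bern_fps_mult_exp
      by (simp add: fps_of_nat [symmetric] mult.assoc flip: fps_const_mult)
    also have "\<dots> = b * S * ?Y"
      unfolding S by (simp only: mult_ac)
    finally have bS: "of_nat p * bern_fps ?k = b * S"
      using Y0 by simp
    \<comment> \<open>\<open>S\<close> equals \<open>((1 + ?Y) ^ p - 1) / ?Y\<close>. Its inner
      binomial coefficients are divisible by \<open>p\<close>, and \<open>T\<close> collects their
      quotients.\<close>
    define T where "T = (\<Sum>i=1..<p. of_nat ((p choose i) div p) * ?Y ^ (i - 1))"
    have "?Y * S = (?Y + 1) ^ p - 1"
      using S by (simp add: fps_exp_power_mult)
    also have "\<dots> = (\<Sum>i\<in>{1..p}. of_nat (p choose i) * ?Y ^ i)"
      unfolding binomial_ring by (simp add: atMost_atLeast0 sum.atLeast_Suc_atMost)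
    also have "{1..p} = insert p {1..<p}"
      using p0 by auto
    also have "(\<Sum>i\<in>insert p {1..<p}. of_nat (p choose i) * ?Y ^ i) =
        ?Y ^ p + (\<Sum>i=1..<p. ?Y * (of_nat p * (of_nat ((p choose i) div p) * ?Y ^ (i - 1))))"
    proof -
      have "of_nat (p choose i) * ?Y ^ i = ?Y * (of_nat p * (of_nat ((p choose i) div p) * ?Y ^ (i - 1)))"
        if "i \<in> {1..<p}" for i
      proof -
        have "p dvd (p choose i)"
          using that p by (intro dvd_choose_prime) auto
        then have "of_nat (p choose i) = (of_nat p * of_nat ((p choose i) div p) :: rat fps)"
          by (metis dvd_mult_div_cancel of_nat_mult)
        moreover have "?Y ^ i = ?Y * ?Y ^ (i - 1)"
          using that by (cases i) auto
        ultimately show ?thesis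
          by (simp only: mult_ac)
      qed
      then show ?thesis
        by simp
    qed
    also have "\<dots> = ?Y * (?Y ^ (p - 1) + of_nat p * T)"
      using p0 unfolding T_def
      by (simp add: sum_distrib_left distrib_left flip: power_Suc)
    finally have ST: "S = ?Y ^ (p - 1) + of_nat p * T"
      using Y0 by simp
    obtain c where c: "(fact (k + p - 1) :: nat) = p * c * fact k"
      using prime_dvd_fact_quotient [OF p False] by blast
    \<comment> \<open>Replacing \<open>?Y\<close> by \<open>(e^y - 1) * W\<close> merges
      \<open>?Y ^ (p - 1) * ?G\<close> into \<open>(e^y - 1) ^ (k + p - 1) / k!\<close>; the
      factorial quotient \<open>p * c\<close> then supplies the factor \<open>p\<close>.\<close>
    define V where "V = of_nat c * W ^ (p - 1) * Stirling_egf (k + p - 1)"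
    have VG: "?Y ^ (p - 1) * ?G = of_nat p * V"
    proof -
      have "k + p - 1 = p - 1 + k"
        using p0 by simp
      then have "(fps_exp 1 - 1) ^ (k + p - 1) = (fps_exp 1 - 1) ^ (p - 1) * (fps_const (fact k) * ?G)"
        unfolding fact_mult_Stirling_egf by (simp only: power_add)
      then have "fps_const (fact k) * (?Y ^ (p - 1) * ?G) = W ^ (p - 1) * (fps_exp 1 - 1) ^ (k + p - 1)"
        unfolding W by (simp only: power_mult_distrib mult_ac)
      also have "\<dots> = fps_const (of_nat (fact (k + p - 1))) * W ^ (p - 1) * Stirling_egf (k + p - 1)"
        by (simp add: mult_ac flip: fact_mult_Stirling_egf)
      also have "\<dots> = fps_const (fact k) * (of_nat p * V)"
        unfolding c V_def by (simp add: fps_of_nat [symmetric] mult_ac flip: fps_const_mult)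
      finally show ?thesis
        by simp
    qed
    have "of_nat p * (bern_fps ?k * ?G) = b * (S * ?G)"
      using bS by (simp add: mult.assoc [symmetric])
    also have "S * ?G = of_nat p * (V + T * ?G)"
      unfolding ST distrib_right VG by (simp add: algebra_simps)
    \<comment> \<open>The factor \<open>p\<close> cancels, and \<open>b\<close>, \<open>V\<close>,
      \<open>T\<close> and \<open>?G\<close> are all \<open>p\<close>-integral.\<close>
    finally have "bern_fps ?k * ?G = b * (V + T * ?G)"
      using p0 by (simp add: mult.left_commute [of b])
    moreover have W': "local_egf p W"
      unfolding W_def by auto
    moreover have "local_egf p V"
      unfolding V_def using W' by auto
    moreover have "local_egf p T"
    proof -
      have "?Y = Stirling_egf 1 * W"
        using fact_mult_Stirling_egf [of 1] W by simp
      then have "local_egf p ?Y"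
        using W' by auto
      then show ?thesis
        unfolding T_def by auto
    qed
    moreover have "local_egf p b"
      unfolding b_def by (rule local_egf_bern_fps [OF p]) simp
    ultimately show ?thesis
      by auto
  qed auto
  then show ?thesis
    by (simp add: local_egf_def stirlB_egf)
qed

theorem theorem6p1:
  shows "(\<forall>n k :: nat. \<B> n k \<in> \<int> \<and> (odd (int n - int k) \<longrightarrow> \<B> n k = 0)) \<and>
    (\<forall>n x :: nat. n \<le> x \<longrightarrow>
       \<B> x (x - n) = Sum_any (\<lambda>u. ibinom (int n + int x) (int n - int u)
                                * ibinom (int n - int x) (int n + int u) * \<A> (n + u) u) \<and>
       \<A> x (x - n) = Sum_any (\<lambda>u. ibinom (int n + int x) (int n - int u)
                                * ibinom (int n - int x) (int n + int u) * \<B> (n + u) u))"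
  using Ints_if_local_int [OF local_int_stirlB] stirlB_odd stirlB_duality stirlA_duality by simp

end
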